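(* Let $n\ge 2$ and $N\in\mathbb{N}=\{1,2,\dots\}$. For every polyharmonic function $u$ of order $N$ on $\mathbb{B}$ there exist unique functions $w_0,\dots,w_{N-1}$ on $\mathbb{B}$ satisfying $\mathbf{L}_{N-j-1}[w_j]=0$ on $\mathbb{B}$ for $j=0,\dots,N-1$, such that $$u(x)=w_0(x)+(1-|x|^2)w_1(x)+\cdots+(1-|x|^2)^{N-1}w_{N-1}(x),\qquad x\in\mathbb{B}.$$
   Context: $\mathbb{B}$ is the open unit ball of $\mathbb{R}^n$. A function $u:\mathbb{B}\to\mathbb{C}$ is polyharmonic of order $N$ ($N$-harmonic) if it is $2N$ times continuously differentiable and $\Delta^N u=0$ in $\mathbb{B}$. For $\theta\in\mathbb{R}$, $\mathbf{L}_\theta$ is the second order differential operator (acting on twice continuously differentiable complex-valued functions on $\mathbb{B}$) $$\mathbf{L}_\theta[u](x):=(1-|x|^2)\Delta u(x)+4\theta\,\mathbf{R}[u](x)+2\theta(n-2-2\theta)u(x),$$ where $\mathbf{R}[u](x):=x\cdot\nabla u(x)$ is the radial derivative. *)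

theory Defs
  imports "HOL-Analysis.Analysis"
begin

definition partial_deriv :: "'a::euclidean_space \<Rightarrow> ('a \<Rightarrow> 'b::real_normed_vector) \<Rightarrow> 'a \<Rightarrow> 'b" where
  "partial_deriv b f x = frechet_derivative f (at x) b"

text \<open>
  \<open>Ck_on k f S\<close>: \<open>f\<close> is \<open>k\<close> times continuously differentiable on \<open>S\<close>. It is meant for open \<open>S\<close>,
  as all derivatives are taken in the whole space. For \<open>S\<close> open, the values of \<open>f\<close> outside \<open>S\<close>
  are irrelevant.
\<close>

primrec Ck_on :: "nat \<Rightarrow> ('a::euclidean_space \<Rightarrow> 'b::real_normed_vector) \<Rightarrow> 'a set \<Rightarrow> bool" where
  "Ck_on 0 f S \<longleftrightarrow> continuous_on S f"
| "Ck_on (Suc k) f S \<longleftrightarrow>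
     (\<forall>x\<in>S. f differentiable (at x)) \<and> (\<forall>b\<in>Basis. Ck_on k (partial_deriv b f) S)"

definition laplacian :: "('a::euclidean_space \<Rightarrow> 'b::real_normed_vector) \<Rightarrow> 'a \<Rightarrow> 'b" where
  "laplacian f x = (\<Sum>b\<in>Basis. partial_deriv b (partial_deriv b f) x)"

definition radial_deriv :: "('a::euclidean_space \<Rightarrow> 'b::real_normed_vector) \<Rightarrow> 'a \<Rightarrow> 'b" where
  "radial_deriv f x = (\<Sum>b\<in>Basis. (x \<bullet> b) *\<^sub>R partial_deriv b f x)"

definition polyharmonic :: "nat \<Rightarrow> ('a::euclidean_space \<Rightarrow> complex) \<Rightarrow> bool" where
  "polyharmonic N u \<longleftrightarrow>
     Ck_on (2 * N) u (ball 0 1) \<and> (\<forall>x\<in>ball 0 1. (laplacian ^^ N) u x = 0)"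

definition L_op :: "real \<Rightarrow> ('a::euclidean_space \<Rightarrow> complex) \<Rightarrow> 'a \<Rightarrow> complex" where
  "L_op \<theta> u x =
     (1 - (norm x)\<^sup>2) *\<^sub>R laplacian u x + (4 * \<theta>) *\<^sub>R radial_deriv u x
     + (2 * \<theta> * (real DIM('a) - 2 - 2 * \<theta>)) *\<^sub>R u x"

text \<open>The operator acts on twice continuously differentiable functions, so a solution of
  the equation is required to be of this class.\<close>

definition L_solution :: "real \<Rightarrow> ('a::euclidean_space \<Rightarrow> complex) \<Rightarrow> bool" where
  "L_solution \<theta> w \<longleftrightarrow> Ck_on 2 w (ball 0 1) \<and> (\<forall>x\<in>ball 0 1. L_op \<theta> w x = 0)"

end

theory Submission
  imports Defs
begin

text \<open>
  Put \<open>\<rho> = 1 - \<bar>x\<bar>\<^sup>2\<close>. Induction on \<open>N\<close> rests on two identities. First, \<open>\<Delta> L\<^sub>\<theta> = L\<^bsub>\<theta>-1\<^esub> \<Delta>\<close>, so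
  \<open>\<Delta>\<^sup>N L\<^sub>N = \<rho> \<Delta>\<^bsup>N+1\<^esup>\<close> and \<open>L\<^sub>N\<close> maps \<open>(N+1)\<close>-harmonic functions to \<open>N\<close>-harmonic ones. Second,
  \<open>L\<^sub>\<theta>[\<rho>\<^sup>j w] = \<rho>\<^sup>j L\<^bsub>\<theta>-j\<^esub>[w] + 4j(j-1-2\<theta>) \<rho>\<^bsup>j-1\<^esup> w\<close>, so \<open>L\<^sub>N\<close> turns a decomposition
  \<open>\<Sum>\<rho>\<^sup>j w\<^sub>j\<close> at level \<open>N+1\<close> into one at level \<open>N\<close> whose components are nonzero multiples of
  \<open>w\<^sub>1, \<dots>, w\<^sub>N\<close>. Hence \<open>L\<^sub>N[u]\<close> determines \<open>w\<^sub>1, \<dots>, w\<^sub>N\<close> by the induction hypothesis, and the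
  remainder \<open>w\<^sub>0 = u - \<Sum>\<rho>\<^sup>j w\<^sub>j\<close> is annihilated by \<open>L\<^sub>N\<close>. Only as many derivatives are used as \<open>u\<close>
  has, so no elliptic regularity is needed.
\<close>

subsection \<open>Partial derivatives and the classes \<open>Ck_on\<close>\<close>

lemma has_derivative_partial_deriv:
  assumes "(f has_derivative f') (at x)"
  shows "partial_deriv b f x = f' b"
  using frechet_derivative_at[OF assms] by (simp add: partial_deriv_def)

lemma partial_deriv_has_vector_derivative:
  fixes f :: "'a::euclidean_space \<Rightarrow> 'b::real_normed_vector" and s :: real
  assumes "f differentiable (at (x + s *\<^sub>R b))"
  shows "((\<lambda>s. f (x + s *\<^sub>R b)) has_vector_derivative partial_deriv b f (x + s *\<^sub>R b)) (at s within T)"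
proof -
  let ?D = "frechet_derivative f (at (x + s *\<^sub>R b))"
  have D: "(f has_derivative ?D) (at (x + s *\<^sub>R b))"
    using assms by (simp add: frechet_derivative_works)
  have "((\<lambda>s. x + s *\<^sub>R b) has_derivative (\<lambda>h. h *\<^sub>R b)) (at s within T)"
    by (auto intro!: derivative_eq_intros)
  from has_derivative_compose[OF this D]
  show ?thesis
    by (simp add: has_vector_derivative_def partial_deriv_def linear_cmul[OF linear_frechet_derivative[OF assms]])
qed

text \<open>Derivatives are local. Formulas established only on the ball can thus be differentiated
  there although the functions are total.\<close>

lemma has_derivative_cong_open:
  assumes "open S" "x \<in> S" "\<And>y. y \<in> S \<Longrightarrow> f y = g y"
  shows "(f has_derivative D) (at x) \<longleftrightarrow> (g has_derivative D) (at x)"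
  by (rule iffI; erule has_derivative_transform_within_open[OF _ assms(1,2)]) (simp_all add: assms(3))

lemma partial_deriv_cong:
  assumes "open S" "x \<in> S" "\<And>y. y \<in> S \<Longrightarrow> f y = g y"
  shows "partial_deriv b f x = partial_deriv b g x"
  by (simp add: partial_deriv_def frechet_derivative_def has_derivative_cong_open[OF assms])

lemma differentiable_cong:
  assumes "open S" "x \<in> S" "\<And>y. y \<in> S \<Longrightarrow> f y = g y"
  shows "f differentiable (at x) \<longleftrightarrow> g differentiable (at x)"
  by (simp add: differentiable_def has_derivative_cong_open[OF assms])

section \<open>Mean value estimates for second differences\<close>

lemma vector_derivative_increment_bound:
  fixes g :: "real \<Rightarrow> 'b::real_normed_vector"
  assumes "0 \<le> t"
    and "\<And>s. s \<in> {0..t} \<Longrightarrow> (g has_vector_derivative g' s) (at s within {0..t})"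
    and "\<And>s. s \<in> {0..t} \<Longrightarrow> norm (g' s) \<le> B"
  shows "norm (g t - g 0) \<le> B * t"
proof -
  have "norm (g t - g 0) \<le> B * norm (t - 0)"
  proof (rule differentiable_bound[where S = "{0..t}" and f' = "\<lambda>s h. h *\<^sub>R g' s"])
    fix s assume s: "s \<in> {0..t}"
    show "(g has_derivative (\<lambda>h. h *\<^sub>R g' s)) (at s within {0..t})"
      using assms(2)[OF s] by (simp add: has_vector_derivative_def)
    show "onorm (\<lambda>h. h *\<^sub>R g' s) \<le> B"
      proof (rule onorm_le)
      show "norm (h *\<^sub>R g' s) \<le> B * norm h" for h
        using mult_right_mono[OF assms(3)[OF s], of "\<bar>h\<bar>"] by (simp add: mult.commute)
    qed
  qed (use assms(1) in auto)
  then show ?thesis using assms(1) by simp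
qed

text \<open>The mean value inequality is used twice: along \<open>c\<close> for
  \<open>partial_deriv b f\<close>, then along \<open>b\<close> for the increment of
  \<open>f\<close> in direction \<open>c\<close>. Subtracting the linear term that \<open>A\<close>
  predicts leaves derivatives of size at most \<open>e\<close>, respectively
  \<open>e * t\<close>.\<close>

lemma second_difference_bound:
  fixes f :: "'a::euclidean_space \<Rightarrow> 'b::real_normed_vector"
  assumes bc: "b \<in> Basis" "c \<in> Basis" and t: "0 \<le> t" "2 * t < d"
    and f: "\<And>y. y \<in> ball x d \<Longrightarrow> f differentiable (at y)"
    and fb: "\<And>y. y \<in> ball x d \<Longrightarrow> partial_deriv b f differentiable (at y)"
    and bound: "\<And>y. y \<in> ball x d \<Longrightarrow> norm (partial_deriv c (partial_deriv b f) y - A) \<le> e"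
  shows "norm (f (x + t *\<^sub>R b + t *\<^sub>R c) - f (x + t *\<^sub>R b) - f (x + t *\<^sub>R c) + f x - t\<^sup>2 *\<^sub>R A) \<le> e * t\<^sup>2"
proof -
  have inball: "x + s *\<^sub>R b + r *\<^sub>R c \<in> ball x d" if "s \<in> {0..t}" "r \<in> {0..t}" for s r
  proof -
    have "norm (s *\<^sub>R b + r *\<^sub>R c) \<le> s + r"
      using norm_triangle_ineq[of "s *\<^sub>R b" "r *\<^sub>R c"] that bc by simp
    also have "\<dots> < d" using that t by simp
    finally show ?thesis
      using dist_add_cancel[of x 0] by (simp add: add.assoc)
  qed
  have inner: "norm (partial_deriv b f (x + s *\<^sub>R b + t *\<^sub>R c) - partial_deriv b f (x + s *\<^sub>R b) - t *\<^sub>R A) \<le> e * t"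
    if s: "s \<in> {0..t}" for s
  proof -
    let ?h = "\<lambda>r. partial_deriv b f (x + s *\<^sub>R b + r *\<^sub>R c) - r *\<^sub>R A"
    have "norm (?h t - ?h 0) \<le> e * t"
    proof (rule vector_derivative_increment_bound[OF t(1)])
      fix r assume r: "r \<in> {0..t}"
      show "(?h has_vector_derivative partial_deriv c (partial_deriv b f) (x + s *\<^sub>R b + r *\<^sub>R c) - A)
          (at r within {0..t})"
        by (auto intro!: derivative_eq_intros partial_deriv_has_vector_derivative fb inball s r)
      show "norm (partial_deriv c (partial_deriv b f) (x + s *\<^sub>R b + r *\<^sub>R c) - A) \<le> e"
        by (rule bound[OF inball[OF s r]])
    qed
    then show ?thesis by (simp add: algebra_simps)
  qed
  \<comment> \<open>\<open>?g t - ?g 0\<close> is the second difference minus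
    \<open>t\<^sup>2 *\<^sub>R A\<close>, and the derivative of \<open>?g\<close> is the quantity
    just bounded.\<close>
  let ?g = "\<lambda>s. f (x + t *\<^sub>R c + s *\<^sub>R b) - f (x + s *\<^sub>R b) - s *\<^sub>R (t *\<^sub>R A)"
  have "norm (?g t - ?g 0) \<le> e * t * t"
  proof (rule vector_derivative_increment_bound[OF t(1)])
    fix s assume s: "s \<in> {0..t}"
    have 1: "x + t *\<^sub>R c + s *\<^sub>R b \<in> ball x d"
      using inball[OF s, of t] t by (simp add: algebra_simps)
    have 2: "x + s *\<^sub>R b \<in> ball x d"
      using inball[OF s, of 0] t by simp
    show "(?g has_vector_derivative partial_deriv b f (x + t *\<^sub>R c + s *\<^sub>R b) - partial_deriv b f (x + s *\<^sub>R b) - t *\<^sub>R A)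
        (at s within {0..t})"
      by (auto intro!: derivative_eq_intros partial_deriv_has_vector_derivative f 1 2)
    show "norm (partial_deriv b f (x + t *\<^sub>R c + s *\<^sub>R b) - partial_deriv b f (x + s *\<^sub>R b) - t *\<^sub>R A) \<le> e * t"
      using inner[OF s] by (simp add: algebra_simps)
  qed
  then show ?thesis by (simp add: algebra_simps power2_eq_square)
qed

section \<open>Locality and monotonicity of the classes \<open>Ck_on\<close>\<close>

lemma Ck_on_cong:
  assumes "open S" "\<And>x. x \<in> S \<Longrightarrow> f x = g x"
  shows "Ck_on k f S \<longleftrightarrow> Ck_on k g S"
  using assms(2)
proof (induction k arbitrary: f g)
  case 0
  then show ?case by (simp cong: continuous_on_cong)
next
  case (Suc k)
  have "Ck_on k (partial_deriv b f) S \<longleftrightarrow> Ck_on k (partial_deriv b g) S" for b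
    by (rule Suc.IH) (use partial_deriv_cong[OF assms(1)] Suc.prems in blast)
  moreover have "f differentiable (at x) \<longleftrightarrow> g differentiable (at x)" if "x \<in> S" for x
    using differentiable_cong[OF assms(1) that] Suc.prems by blast
  ultimately show ?case by simp
qed

text \<open>Differentiability supplies the continuity at the bottom of the induction, since
  \<open>Ck_on (Suc k)\<close> speaks only of differentiability and of the partial
  derivatives.\<close>

lemma Ck_on_SucD: "Ck_on (Suc k) f S \<Longrightarrow> Ck_on k f S"
proof (induction k arbitrary: f)
  case 0
  then show ?case
    by (auto simp: differentiable_imp_continuous_within continuous_at_imp_continuous_on)
next
  case (Suc k)
  then show ?case using Ck_on.simps(2) by blast
qed

lemma Ck_on_mono: "Ck_on k f S \<Longrightarrow> j \<le> k \<Longrightarrow> Ck_on j f S"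
  by (rotate_tac, induction rule: dec_induct) (auto dest: Ck_on_SucD simp del: Ck_on.simps)

lemma Ck_on_differentiable: "Ck_on k f S \<Longrightarrow> k \<noteq> 0 \<Longrightarrow> x \<in> S \<Longrightarrow> f differentiable (at x)"
  by (cases k) auto

lemma Ck_on_partial_deriv: "Ck_on (Suc k) f S \<Longrightarrow> b \<in> Basis \<Longrightarrow> Ck_on k (partial_deriv b f) S"
  by simp

text \<open>Both mixed derivatives are limits of the same symmetric second difference quotient.\<close>

lemma partial_deriv_commute:
  assumes "open S" "x \<in> S" and f: "Ck_on 2 f S" and bc: "b \<in> Basis" "c \<in> Basis"
  shows "partial_deriv b (partial_deriv c f) x = partial_deriv c (partial_deriv b f) x"
proof -
  let ?A = "partial_deriv c (partial_deriv b f)" and ?B = "partial_deriv b (partial_deriv c f)"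
  have cont: "continuous (at x) ?A" "continuous (at x) ?B"
    using f bc assms(1,2) by (auto simp: numeral_2_eq_2 continuous_on_eq_continuous_at)
  have "dist (?A x) (?B x) < e" if "e > 0" for e
  proof -
    obtain d1 where d1: "d1 > 0" "ball x d1 \<subseteq> S"
      using assms(1,2) open_contains_ball by blast
    obtain d2 where d2: "d2 > 0" "\<And>y. dist y x < d2 \<Longrightarrow> dist (?A y) (?A x) < e/4"
      using cont(1)[unfolded continuous_at_eps_delta, rule_format, of "e/4"] \<open>e > 0\<close> by auto
    obtain d3 where d3: "d3 > 0" "\<And>y. dist y x < d3 \<Longrightarrow> dist (?B y) (?B x) < e/4"
      using cont(2)[unfolded continuous_at_eps_delta, rule_format, of "e/4"] \<open>e > 0\<close> by auto
    define d where "d = min d1 (min d2 d3)"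
    \<comment> \<open>A third of the radius keeps all points reached by steps of length at most
      \<open>t\<close> along \<open>b\<close> and \<open>c\<close> in the ball.\<close>
    define t where "t = d / 3"
    have t: "t > 0" "2 * t < d" using d1 d2 d3 by (auto simp: d_def t_def)
    have inS: "y \<in> S" if "y \<in> ball x d" for y using that d1 by (auto simp: d_def)
    have diff: "f differentiable (at y)" "partial_deriv b f differentiable (at y)"
      "partial_deriv c f differentiable (at y)" if "y \<in> ball x d" for y
      using inS[OF that] f bc by (auto simp: numeral_2_eq_2)
    define Q where "Q = f (x + t *\<^sub>R b + t *\<^sub>R c) - f (x + t *\<^sub>R b) - f (x + t *\<^sub>R c) + f x"
    have A: "norm (Q - t\<^sup>2 *\<^sub>R ?A x) \<le> e/4 * t\<^sup>2"
      unfolding Q_def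
    proof (rule second_difference_bound[where d = d and b = b and c = c])
      fix y assume "y \<in> ball x d"
      then show "norm (?A y - ?A x) \<le> e/4"
        using d2(2)[of y] by (simp add: d_def dist_norm norm_minus_commute)
    qed (simp_all add: bc t diff less_imp_le)
    have "norm (f (x + t *\<^sub>R c + t *\<^sub>R b) - f (x + t *\<^sub>R c) - f (x + t *\<^sub>R b) + f x - t\<^sup>2 *\<^sub>R ?B x) \<le> e/4 * t\<^sup>2"
    proof (rule second_difference_bound[where d = d and b = c and c = b])
      fix y assume "y \<in> ball x d"
      then show "norm (?B y - ?B x) \<le> e/4"
        using d3(2)[of y] by (simp add: d_def dist_norm norm_minus_commute)
    qed (simp_all add: bc t diff less_imp_le)
    then have B: "norm (Q - t\<^sup>2 *\<^sub>R ?B x) \<le> e/4 * t\<^sup>2"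
      by (simp add: Q_def algebra_simps)
    have "t\<^sup>2 * dist (?A x) (?B x) = norm (t\<^sup>2 *\<^sub>R ?A x - t\<^sup>2 *\<^sub>R ?B x)"
      by (simp add: dist_norm flip: scaleR_diff_right)
    \<comment> \<open>Each comparison with \<open>Q\<close> costs \<open>e/4\<close>, so the total
      \<open>e/2\<close> stays strictly below \<open>e\<close>.\<close>
    also have "\<dots> \<le> e/4 * t\<^sup>2 + e/4 * t\<^sup>2"
      using norm_triangle_ineq4[of "Q - t\<^sup>2 *\<^sub>R ?B x" "Q - t\<^sup>2 *\<^sub>R ?A x"] A B by simp
    also have "\<dots> = t\<^sup>2 * (e/2)" by simp
    finally have "dist (?A x) (?B x) \<le> e/2"
      using t by (simp only: mult_le_cancel_left_pos zero_less_power)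
    then show ?thesis using \<open>e > 0\<close> by simp
  qed
  \<comment> \<open>A positive distance could itself serve as \<open>e\<close> and would be smaller
    than itself.\<close>
  from this[of "dist (?A x) (?B x)"] show ?thesis by (auto simp: eq_commute)
qed

section \<open>Differentiation rules and closure of \<open>Ck_on\<close>\<close>

lemma partial_deriv_const: "partial_deriv b (\<lambda>x. c) x = 0"
  by (simp add: partial_deriv_def)

lemma partial_deriv_add:
  assumes "f differentiable (at x)" "g differentiable (at x)"
  shows "partial_deriv b (\<lambda>x. f x + g x) x = partial_deriv b f x + partial_deriv b g x"
  using has_derivative_partial_deriv[OF has_derivative_add[OF assms[unfolded frechet_derivative_works]]]
  by (simp add: partial_deriv_def)

lemma partial_deriv_cmult:
  assumes "f differentiable (at x)"
  shows "partial_deriv b (\<lambda>x. r *\<^sub>R f x) x = r *\<^sub>R partial_deriv b f x"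
  using has_derivative_partial_deriv[OF has_derivative_scaleR_right[OF assms[unfolded frechet_derivative_works]]]
  by (simp add: partial_deriv_def)

lemma partial_deriv_scaleR:
  assumes "\<phi> differentiable (at x)" "f differentiable (at x)"
  shows "partial_deriv b (\<lambda>x. \<phi> x *\<^sub>R f x) x = \<phi> x *\<^sub>R partial_deriv b f x + partial_deriv b \<phi> x *\<^sub>R f x"
  using has_derivative_partial_deriv[OF has_derivative_scaleR[OF assms[unfolded frechet_derivative_works]]]
  by (simp add: partial_deriv_def)

lemma partial_deriv_sum:
  assumes "finite I" "\<And>i. i \<in> I \<Longrightarrow> f i differentiable (at x)"
  shows "partial_deriv b (\<lambda>x. \<Sum>i\<in>I. f i x) x = (\<Sum>i\<in>I. partial_deriv b (f i) x)"
  using assms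
proof induction
  case (insert i I)
  then show ?case by (simp add: partial_deriv_add differentiable_sum)
qed (simp add: partial_deriv_const)

lemma partial_deriv_inner:
  "partial_deriv b (\<lambda>x. x \<bullet> c) x = b \<bullet> c"
  by (rule has_derivative_partial_deriv) (auto intro!: derivative_eq_intros)

lemma Ck_on_const: "Ck_on k (\<lambda>x. c) S"
proof (induction k arbitrary: c)
  case (Suc k)
  have "partial_deriv b (\<lambda>x. c) = (\<lambda>x. 0)" for b :: 'a
    by (simp add: fun_eq_iff partial_deriv_const)
  with Suc show ?case by simp
qed simp

lemma Ck_on_inner: "Ck_on k (\<lambda>x. x \<bullet> c) S"
proof (cases k)
  case (Suc j)
  have "partial_deriv b (\<lambda>x. x \<bullet> c) = (\<lambda>x. b \<bullet> c)" for b :: 'a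
    by (simp add: fun_eq_iff partial_deriv_inner)
  with Suc show ?thesis by (simp add: Ck_on_const)
qed (auto intro!: continuous_intros)

lemma Ck_on_add:
  assumes "open S"
  shows "Ck_on k f S \<Longrightarrow> Ck_on k g S \<Longrightarrow> Ck_on k (\<lambda>x. f x + g x) S"
proof (induction k arbitrary: f g)
  case 0
  then show ?case by (simp add: continuous_on_add)
next
  case (Suc k)
  have "Ck_on k (partial_deriv b (\<lambda>x. f x + g x)) S" if b: "b \<in> Basis" for b
  proof -
    have "Ck_on k (\<lambda>x. partial_deriv b f x + partial_deriv b g x) S"
      using Suc b by simp
    then show ?thesis
      by (subst Ck_on_cong[OF assms]) (use Suc.prems in \<open>auto simp: partial_deriv_add\<close>)
  qed
  then show ?case using Suc.prems by simp
qed

lemma Ck_on_scaleR: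
  assumes "open S"
  shows "Ck_on k \<phi> S \<Longrightarrow> Ck_on k f S \<Longrightarrow> Ck_on k (\<lambda>x. \<phi> x *\<^sub>R f x) S"
proof (induction k arbitrary: \<phi> f)
  case 0
  then show ?case by (simp add: continuous_on_scaleR)
next
  case (Suc k)
  have "Ck_on k (partial_deriv b (\<lambda>x. \<phi> x *\<^sub>R f x)) S" if b: "b \<in> Basis" for b
  proof -
    have "Ck_on k (\<lambda>x. \<phi> x *\<^sub>R partial_deriv b f x + partial_deriv b \<phi> x *\<^sub>R f x) S"
      by (intro Ck_on_add[OF assms] Suc.IH Ck_on_SucD[OF Suc.prems(1)] Ck_on_SucD[OF Suc.prems(2)]
          Ck_on_partial_deriv[OF Suc.prems(1) b] Ck_on_partial_deriv[OF Suc.prems(2) b])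
    \<comment> \<open>The product rule is available only at points of \<open>S\<close>, so it enters
      through the congruence for \<open>Ck_on\<close>.\<close>
    then show ?thesis
      by (subst Ck_on_cong[OF assms]) (use Suc.prems in \<open>auto simp: partial_deriv_scaleR\<close>)
  qed
  then show ?case using Suc.prems by simp
qed

lemma Ck_on_cmult: "open S \<Longrightarrow> Ck_on k f S \<Longrightarrow> Ck_on k (\<lambda>x. r *\<^sub>R f x) S"
  by (rule Ck_on_scaleR[OF _ Ck_on_const])

lemma Ck_on_sum:
  assumes "open S" "finite I" "\<And>i. i \<in> I \<Longrightarrow> Ck_on k (f i) S"
  shows "Ck_on k (\<lambda>x. \<Sum>i\<in>I. f i x) S"
  using assms(2,3) by induction (auto intro: Ck_on_const Ck_on_add[OF assms(1)])

lemma Ck_on_laplacian: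
  assumes "open S" "Ck_on (Suc (Suc k)) f S"
  shows "Ck_on k (laplacian f) S"
  using assms Ck_on_sum[OF assms(1) finite_Basis, of k "\<lambda>b. partial_deriv b (partial_deriv b f)"]
  by (simp add: laplacian_def[abs_def])

lemma Ck_on_radial_deriv:
  assumes "open S" "Ck_on (Suc k) f S"
  shows "Ck_on k (radial_deriv f) S"
  using Ck_on_sum[OF assms(1) finite_Basis, of k "\<lambda>b x. (x \<bullet> b) *\<^sub>R partial_deriv b f x"] assms
  by (simp add: radial_deriv_def[abs_def] Ck_on_scaleR Ck_on_inner)

subsection \<open>The Laplacian and the radial derivative\<close>

lemma laplacian_cong:
  assumes "open S" "x \<in> S" "\<And>y. y \<in> S \<Longrightarrow> f y = g y"
  shows "laplacian f x = laplacian g x"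
  unfolding laplacian_def
  by (intro sum.cong refl partial_deriv_cong[OF assms(1,2)] partial_deriv_cong[OF assms(1)] assms(3))

lemma radial_deriv_cong:
  assumes "open S" "x \<in> S" "\<And>y. y \<in> S \<Longrightarrow> f y = g y"
  shows "radial_deriv f x = radial_deriv g x"
  unfolding radial_deriv_def using partial_deriv_cong[OF assms] by simp

lemma radial_deriv_add:
  assumes "f differentiable (at x)" "g differentiable (at x)"
  shows "radial_deriv (\<lambda>x. f x + g x) x = radial_deriv f x + radial_deriv g x"
  unfolding radial_deriv_def
  by (simp add: partial_deriv_add[OF assms] scaleR_add_right sum.distrib)

lemma radial_deriv_cmult:
  assumes "f differentiable (at x)"
  shows "radial_deriv (\<lambda>x. r *\<^sub>R f x) x = r *\<^sub>R radial_deriv f x"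
  unfolding radial_deriv_def
  by (simp add: partial_deriv_cmult[OF assms] scaleR_sum_right mult.commute)

lemma radial_deriv_sum:
  assumes "finite I" "\<And>i. i \<in> I \<Longrightarrow> f i differentiable (at x)"
  shows "radial_deriv (\<lambda>x. \<Sum>i\<in>I. f i x) x = (\<Sum>i\<in>I. radial_deriv (f i) x)"
  unfolding radial_deriv_def
  by (simp add: partial_deriv_sum[OF assms] scaleR_sum_right sum.swap[of _ I])

lemma Ck_on_2_differentiable:
  assumes "Ck_on 2 f S" "x \<in> S" "b \<in> Basis"
  shows "f differentiable (at x)" "partial_deriv b f differentiable (at x)"
  using assms by (auto simp: numeral_2_eq_2)

lemma laplacian_scaleR:
  assumes "open S" "x \<in> S" "Ck_on 2 \<phi> S" "Ck_on 2 f S"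
  shows "laplacian (\<lambda>x. \<phi> x *\<^sub>R f x) x = \<phi> x *\<^sub>R laplacian f x
    + 2 *\<^sub>R (\<Sum>b\<in>Basis. partial_deriv b \<phi> x *\<^sub>R partial_deriv b f x) + laplacian \<phi> x *\<^sub>R f x"
proof -
  note diff = Ck_on_2_differentiable[OF assms(3)] Ck_on_2_differentiable[OF assms(4)]
  have "partial_deriv b (partial_deriv b (\<lambda>x. \<phi> x *\<^sub>R f x)) x
      = \<phi> x *\<^sub>R partial_deriv b (partial_deriv b f) x
        + 2 *\<^sub>R (partial_deriv b \<phi> x *\<^sub>R partial_deriv b f x)
        + partial_deriv b (partial_deriv b \<phi>) x *\<^sub>R f x" if b: "b \<in> Basis" for b
  proof -
    have "partial_deriv b (partial_deriv b (\<lambda>x. \<phi> x *\<^sub>R f x)) x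
      = partial_deriv b (\<lambda>x. \<phi> x *\<^sub>R partial_deriv b f x + partial_deriv b \<phi> x *\<^sub>R f x) x"
      by (rule partial_deriv_cong[OF assms(1,2)]) (use diff b in \<open>simp add: partial_deriv_scaleR\<close>)
    also have "\<dots> = \<phi> x *\<^sub>R partial_deriv b (partial_deriv b f) x + partial_deriv b \<phi> x *\<^sub>R partial_deriv b f x
        + (partial_deriv b \<phi> x *\<^sub>R partial_deriv b f x + partial_deriv b (partial_deriv b \<phi>) x *\<^sub>R f x)"
      using diff[OF assms(2) b] by (simp add: partial_deriv_add partial_deriv_scaleR)
    finally show ?thesis by (simp only: scaleR_2 add.assoc)
  qed
  then show ?thesis
    by (simp add: laplacian_def sum.distrib scaleR_sum_right scaleR_sum_left)
qed

lemma laplacian_add: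
  assumes "open S" "x \<in> S" "Ck_on 2 f S" "Ck_on 2 g S"
  shows "laplacian (\<lambda>x. f x + g x) x = laplacian f x + laplacian g x"
proof -
  note diff = Ck_on_2_differentiable[OF assms(3)] Ck_on_2_differentiable[OF assms(4)]
  have "partial_deriv b (partial_deriv b (\<lambda>x. f x + g x)) x
      = partial_deriv b (partial_deriv b f) x + partial_deriv b (partial_deriv b g) x"
    if b: "b \<in> Basis" for b
  proof -
    have "partial_deriv b (partial_deriv b (\<lambda>x. f x + g x)) x
      = partial_deriv b (\<lambda>x. partial_deriv b f x + partial_deriv b g x) x"
      by (rule partial_deriv_cong[OF assms(1,2)]) (use diff b in \<open>simp add: partial_deriv_add\<close>)
    then show ?thesis
      using diff[OF assms(2) b] by (simp add: partial_deriv_add)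
  qed
  then show ?thesis
    by (simp add: laplacian_def sum.distrib)
qed

lemma laplacian_cmult:
  assumes "open S" "x \<in> S" "Ck_on 2 f S"
  shows "laplacian (\<lambda>x. r *\<^sub>R f x) x = r *\<^sub>R laplacian f x"
proof -
  have "partial_deriv b (\<lambda>x. r) = (\<lambda>x. 0)" for b :: 'a
    by (simp add: fun_eq_iff partial_deriv_const)
  then show ?thesis
    using laplacian_scaleR[OF assms(1,2) Ck_on_const assms(3), of r]
    by (simp add: laplacian_def[of "\<lambda>x. r"] partial_deriv_const)
qed

text \<open>Differentiating the coefficients \<open>x \<bullet> c\<close> yields the extra term; the
  rest is the radial derivative of \<open>partial_deriv b f\<close> once second derivatives are
  interchanged.\<close>

lemma partial_deriv_radial_deriv:
  assumes "open S" "x \<in> S" "Ck_on 2 f S" "b \<in> Basis"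
  shows "partial_deriv b (radial_deriv f) x = partial_deriv b f x + radial_deriv (partial_deriv b f) x"
proof -
  have inner: "(\<lambda>x. x \<bullet> c) differentiable (at x)" for c :: 'a
    by (auto intro!: derivative_intros)
  note diff = Ck_on_2_differentiable[OF assms(3,2)]
  have "partial_deriv b (radial_deriv f) x
      = (\<Sum>c\<in>Basis. (x \<bullet> c) *\<^sub>R partial_deriv b (partial_deriv c f) x + (b \<bullet> c) *\<^sub>R partial_deriv c f x)"
    unfolding radial_deriv_def[abs_def] using diff inner
    by (subst partial_deriv_sum) (auto simp: partial_deriv_scaleR partial_deriv_inner)
  \<comment> \<open>Orthonormality of \<open>Basis\<close> leaves only \<open>c = b\<close> in the
    second sum.\<close>
  also have "\<dots> = (\<Sum>c\<in>Basis. (x \<bullet> c) *\<^sub>R partial_deriv c (partial_deriv b f) x)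
      + (\<Sum>c\<in>Basis. if c = b then partial_deriv c f x else 0)"
    unfolding sum.distrib using assms(4)
    by (intro arg_cong2[where f = "(+)"] sum.cong) (auto simp: inner_Basis partial_deriv_commute[OF assms(1-3)])
  finally show ?thesis
    using assms(4) by (simp add: radial_deriv_def)
qed

text \<open>Moving each of the two derivatives past the radial derivative costs one copy of
  \<open>partial_deriv b (partial_deriv b f)\<close>, hence the factor 2. Class 3 lets the
  commutation rule be applied to \<open>partial_deriv b f\<close> as well.\<close>

lemma laplacian_radial_deriv:
  assumes "open S" "x \<in> S" "Ck_on 3 f S"
  shows "laplacian (radial_deriv f) x = radial_deriv (laplacian f) x + 2 *\<^sub>R laplacian f x"
proof -
  have C2: "Ck_on 2 f S" "Ck_on 2 (partial_deriv b f) S" if "b \<in> Basis" for b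
    using assms(3) that Ck_on_mono[OF assms(3), of 2] by (auto simp: numeral_3_eq_3 numeral_2_eq_2)
  have "partial_deriv b (partial_deriv b (radial_deriv f)) x
     = radial_deriv (partial_deriv b (partial_deriv b f)) x + 2 *\<^sub>R partial_deriv b (partial_deriv b f) x"
    if b: "b \<in> Basis" for b
  proof -
    have "Ck_on 1 (radial_deriv (partial_deriv b f)) S"
      using C2(2)[OF b] by (intro Ck_on_radial_deriv assms(1)) (simp add: numeral_2_eq_2)
    then have "radial_deriv (partial_deriv b f) differentiable (at x)"
      by (rule Ck_on_differentiable) (use assms in auto)
    moreover have "partial_deriv b (partial_deriv b (radial_deriv f)) x
       = partial_deriv b (\<lambda>x. partial_deriv b f x + radial_deriv (partial_deriv b f) x) x"
      by (rule partial_deriv_cong[OF assms(1,2)])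
        (use partial_deriv_radial_deriv[OF assms(1) _ C2(1)[OF b] b] in auto)
    ultimately show ?thesis
      using Ck_on_2_differentiable[OF C2(1)[OF b] assms(2) b]
        partial_deriv_radial_deriv[OF assms(1,2) C2(2)[OF b] b]
      by (simp add: partial_deriv_add scaleR_2)
  qed
  moreover have "radial_deriv (laplacian f) x = (\<Sum>b\<in>Basis. radial_deriv (partial_deriv b (partial_deriv b f)) x)"
    unfolding laplacian_def[abs_def]
    by (rule radial_deriv_sum) (use Ck_on_2_differentiable(2)[OF C2(2) assms(2)] in auto)
  ultimately show ?thesis
    by (simp add: laplacian_def sum.distrib scaleR_sum_right)
qed

section \<open>The weight \<open>rho\<close> and products with it\<close>

abbreviation rho :: "'a::euclidean_space \<Rightarrow> real" where
  "rho x \<equiv> 1 - (norm x)\<^sup>2"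

lemma rho_has_derivative: "(rho has_derivative (\<lambda>h. -2 * (x \<bullet> h))) (at x)"
  unfolding power2_norm_eq_inner
  by (auto intro!: derivative_eq_intros simp: inner_commute)

lemma partial_deriv_rho: "partial_deriv b rho = (\<lambda>x. -2 * (x \<bullet> b))"
  by (rule ext) (rule has_derivative_partial_deriv[OF rho_has_derivative])

lemma Ck_on_rho:
  assumes "open S"
  shows "Ck_on k rho S"
proof (cases k)
  case (Suc j)
  have "rho differentiable (at x)" for x :: 'a
    using rho_has_derivative differentiable_def by blast
  with Suc show ?thesis
    using Ck_on_cmult[OF assms Ck_on_inner, of j "-2"] by (simp add: partial_deriv_rho)
qed (auto intro!: continuous_intros)

lemma Ck_on_rho_power:
  assumes "open S" "Ck_on k f S"
  shows "Ck_on k (\<lambda>x. rho x ^ j *\<^sub>R f x) S"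
proof (induction j)
  case (Suc j)
  then show ?case
    using Ck_on_scaleR[OF assms(1) Ck_on_rho[OF assms(1)] Suc] by simp
qed (use assms in simp)

lemma sum_Basis_norm: "(\<Sum>b\<in>Basis. (x \<bullet> b) * (x \<bullet> b)) = (norm x)\<^sup>2"
  by (simp add: power2_norm_eq_inner euclidean_inner[of x x])

lemma laplacian_rho: "laplacian rho (x::'a::euclidean_space) = - 2 * real DIM('a)"
proof -
  have "partial_deriv b (\<lambda>x. -2 * (x \<bullet> b)) x = -2" if "b \<in> Basis" for b :: 'a
    by (subst has_derivative_partial_deriv[where f' = "\<lambda>h. -2 * (h \<bullet> b)"])
      (use that in \<open>auto intro!: derivative_eq_intros\<close>)
  then show ?thesis by (simp add: laplacian_def partial_deriv_rho)
qed

lemma radial_deriv_rho_scaleR: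
  assumes "f differentiable (at x)"
  shows "radial_deriv (\<lambda>x. rho x *\<^sub>R f x) x = rho x *\<^sub>R radial_deriv f x - (2 * (norm x)\<^sup>2) *\<^sub>R f x"
proof -
  have rho: "rho differentiable (at x)"
    using rho_has_derivative differentiable_def by blast
  have "radial_deriv (\<lambda>x. rho x *\<^sub>R f x) x
    = (\<Sum>b\<in>Basis. rho x *\<^sub>R ((x \<bullet> b) *\<^sub>R partial_deriv b f x) - (2 * ((x \<bullet> b) * (x \<bullet> b))) *\<^sub>R f x)"
    unfolding radial_deriv_def partial_deriv_scaleR[OF rho assms] partial_deriv_rho
    by (intro sum.cong refl) (simp add: algebra_simps)
  then show ?thesis
    by (simp add: radial_deriv_def sum_subtractf scaleR_sum_right flip: scaleR_sum_left sum_distrib_left sum_Basis_norm)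
qed

text \<open>The gradient -2x of \<open>rho\<close> turns the mixed term of the product rule into -4
  times the radial derivative.\<close>

lemma laplacian_rho_scaleR:
  fixes f :: "'a::euclidean_space \<Rightarrow> 'b::real_normed_vector"
  assumes "open S" "x \<in> S" "Ck_on 2 f S"
  shows "laplacian (\<lambda>x. rho x *\<^sub>R f x) x
    = rho x *\<^sub>R laplacian f x - 4 *\<^sub>R radial_deriv f x - (2 * real DIM('a)) *\<^sub>R f x"
  unfolding laplacian_scaleR[OF assms(1,2) Ck_on_rho[OF assms(1)] assms(3)] laplacian_rho partial_deriv_rho
  by (simp add: radial_deriv_def scaleR_sum_right sum_negf)

subsection \<open>The operators \<open>L_op \<theta>\<close>\<close>

lemma L_op_cong:
  assumes "open S" "x \<in> S" "\<And>y. y \<in> S \<Longrightarrow> f y = g y"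
  shows "L_op \<theta> f x = L_op \<theta> g x"
  using laplacian_cong[OF assms] radial_deriv_cong[OF assms] assms(2,3) by (simp add: L_op_def)

lemma L_op_add:
  assumes "open S" "x \<in> S" "Ck_on 2 f S" "Ck_on 2 g S"
  shows "L_op \<theta> (\<lambda>x. f x + g x) x = L_op \<theta> f x + L_op \<theta> g x"
  using Ck_on_differentiable[OF assms(3) _ assms(2)] Ck_on_differentiable[OF assms(4) _ assms(2)]
  by (simp add: L_op_def laplacian_add[OF assms] radial_deriv_add scaleR_add_right)

lemma L_op_cmult:
  assumes "open S" "x \<in> S" "Ck_on 2 f S"
  shows "L_op \<theta> (\<lambda>x. r *\<^sub>R f x) x = r *\<^sub>R L_op \<theta> f x"
  using Ck_on_differentiable[OF assms(3) _ assms(2)]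
  by (simp add: L_op_def laplacian_cmult[OF assms] radial_deriv_cmult scaleR_add_right mult.commute)

lemma Ck_on_diff: "open S \<Longrightarrow> Ck_on k f S \<Longrightarrow> Ck_on k g S \<Longrightarrow> Ck_on k (\<lambda>x. f x - g x) S"
  using Ck_on_add[of S k f "\<lambda>x. (-1) *\<^sub>R g x"] Ck_on_cmult[of S k g "-1"] by simp

lemma L_op_diff:
  assumes "open S" "x \<in> S" "Ck_on 2 f S" "Ck_on 2 g S"
  shows "L_op \<theta> (\<lambda>x. f x - g x) x = L_op \<theta> f x - L_op \<theta> g x"
  using L_op_add[OF assms(1-3) Ck_on_cmult[OF assms(1,4), of "-1"], of \<theta>] L_op_cmult[OF assms(1,2,4), of \<theta> "-1"]
  by simp

lemma L_op_sum:
  assumes "open S" "x \<in> S" "finite I" "\<And>i. i \<in> I \<Longrightarrow> Ck_on 2 (f i) S"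
  shows "L_op \<theta> (\<lambda>x. \<Sum>i\<in>I. f i x) x = (\<Sum>i\<in>I. L_op \<theta> (f i) x)"
  using assms(3,4)
proof induction
  case empty
  show ?case
    using L_op_cmult[OF assms(1,2) Ck_on_const, of \<theta> 0 0] by simp
next
  case (insert i I)
  then show ?case
    by (simp add: L_op_add[OF assms(1,2)] Ck_on_sum[OF assms(1)])
qed

lemma Ck_on_L_op:
  assumes "open S" "Ck_on (Suc (Suc k)) f S"
  shows "Ck_on k (L_op \<theta> f) S"
  unfolding L_op_def[abs_def]
  by (intro Ck_on_add[OF assms(1)] Ck_on_scaleR[OF assms(1) Ck_on_rho[OF assms(1)]] Ck_on_cmult[OF assms(1)]
      Ck_on_laplacian[OF assms] Ck_on_radial_deriv[OF assms(1) Ck_on_SucD[OF assms(2)]]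
      Ck_on_SucD[OF Ck_on_SucD[OF assms(2)]] assms(1))

text \<open>The term -4 \<open>radial_deriv f\<close> lowers the radial coefficient from 4\<theta>
  to 4(\<theta>-1). Writing |x|^2 = 1 - \<open>rho x\<close> in -8\<theta>|x|^2 f splits off
  -8\<theta> f; the remaining multiple of \<open>rho x *\<^sub>R f x\<close> is -2n + 8\<theta> +
  2\<theta>(n-2-2\<theta>) = 2(\<theta>-1)(n-2\<theta>), the constant of
  \<open>L_op (\<theta> - 1)\<close>.\<close>

lemma L_op_rho_scaleR:
  assumes "open S" "x \<in> S" "Ck_on 2 f S"
  shows "L_op \<theta> (\<lambda>x. rho x *\<^sub>R f x) x = rho x *\<^sub>R L_op (\<theta> - 1) f x - (8 * \<theta>) *\<^sub>R f x"
  using Ck_on_differentiable[OF assms(3) _ assms(2)]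
  by (simp add: L_op_def laplacian_rho_scaleR[OF assms] radial_deriv_rho_scaleR)
    (simp add: algebra_simps scaleR_conv_of_real power2_eq_square)

text \<open>The factor \<open>rho x\<close> avoids the exponent \<open>j - 1\<close>, which truncates at \<open>j = 0\<close>.\<close>

lemma L_op_rho_power_scaleR:
  assumes "open S" "x \<in> S" "Ck_on 2 f S"
  shows "rho x *\<^sub>R L_op \<theta> (\<lambda>x. rho x ^ j *\<^sub>R f x) x
    = rho x ^ Suc j *\<^sub>R L_op (\<theta> - real j) f x
      + (4 * real j * (real j - 1 - 2 * \<theta>) * rho x ^ j) *\<^sub>R f x"
proof (induction j arbitrary: \<theta>)
  case (Suc j)
  have "L_op \<theta> (\<lambda>x. rho x ^ Suc j *\<^sub>R f x) x
    = rho x *\<^sub>R L_op (\<theta> - 1) (\<lambda>x. rho x ^ j *\<^sub>R f x) x - (8 * \<theta>) *\<^sub>R (rho x ^ j *\<^sub>R f x)"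
    using L_op_rho_scaleR[OF assms(1,2) Ck_on_rho_power[OF assms(1,3), of j], of \<theta>] by simp
  then have "rho x *\<^sub>R L_op \<theta> (\<lambda>x. rho x ^ Suc j *\<^sub>R f x) x
    = rho x *\<^sub>R (rho x ^ Suc j *\<^sub>R L_op (\<theta> - 1 - real j) f x
        + (4 * real j * (real j - 1 - 2 * (\<theta> - 1)) * rho x ^ j) *\<^sub>R f x)
      - rho x *\<^sub>R (8 * \<theta>) *\<^sub>R (rho x ^ j *\<^sub>R f x)"
    by (simp only: Suc.IH scaleR_diff_right)
  \<comment> \<open>The coefficients combine by 4j(j+1-2\<theta>) - 8\<theta> =
    4(j+1)(j-2\<theta>).\<close>
  also have "\<dots> = rho x ^ Suc (Suc j) *\<^sub>R L_op (\<theta> - real (Suc j)) f x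
      + (4 * real (Suc j) * (real (Suc j) - 1 - 2 * \<theta>) * rho x ^ Suc j) *\<^sub>R f x"
  proof -
    have "\<theta> - 1 - real j = \<theta> - real (Suc j)" by simp
    then show ?thesis
      by (simp only:) (simp add: algebra_simps scaleR_conv_of_real)
  qed
  finally show ?case .
qed (use assms in simp)

text \<open>Commuting the Laplacian with \<open>rho\<close> contributes -4 times the radial
  derivative and -2n, and commuting it with the radial derivative contributes 8\<theta>, all acting
  on \<open>laplacian f\<close>; the constants add up as in \<open>L_op_rho_scaleR\<close>. Class 4
  makes \<open>laplacian f\<close> of class 2.\<close>

lemma laplacian_L_op:
  assumes "open S" "x \<in> S" "Ck_on 4 f S"
  shows "laplacian (L_op \<theta> f) x = L_op (\<theta> - 1) (laplacian f) x"
proof -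
  have C2: "Ck_on 2 f S" and C3: "Ck_on 3 f S"
    by (rule Ck_on_mono[OF assms(3)], simp)+
  have CL: "Ck_on 2 (laplacian f) S" and CR: "Ck_on 2 (radial_deriv f) S"
    using Ck_on_laplacian[OF assms(1), of 2 f] Ck_on_radial_deriv[OF assms(1), of 2 f] assms(3) C3
    by (simp_all add: eval_nat_numeral del: Ck_on.simps)
  note P = Ck_on_scaleR[OF assms(1) Ck_on_rho[OF assms(1)] CL]
    and Q = Ck_on_cmult[OF assms(1) CR] and R = Ck_on_cmult[OF assms(1) C2]
  show ?thesis
    unfolding L_op_def[of \<theta>, abs_def] laplacian_add[OF assms(1,2) Ck_on_add[OF assms(1) P Q] R]
      laplacian_add[OF assms(1,2) P Q] laplacian_rho_scaleR[OF assms(1,2) CL]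
      laplacian_cmult[OF assms(1,2) CR] laplacian_cmult[OF assms(1,2) C2] laplacian_radial_deriv[OF assms(1,2) C3]
    by (simp add: L_op_def algebra_simps scaleR_conv_of_real)
qed

section \<open>Iterated Laplacians and reduction of the order\<close>

lemma laplacian_funpow_cong:
  assumes "open S" "x \<in> S" "\<And>y. y \<in> S \<Longrightarrow> f y = g y"
  shows "(laplacian ^^ k) f x = (laplacian ^^ k) g x"
  using assms(2)
proof (induction k arbitrary: x)
  case (Suc k)
  then show ?case using laplacian_cong[OF assms(1) Suc.prems Suc.IH] by simp
qed (use assms in simp)

lemma laplacian_funpow_L_op:
  assumes "open S" "x \<in> S" "Ck_on (2 * k + 2) f S"
  shows "(laplacian ^^ k) (L_op \<theta> f) x = L_op (\<theta> - real k) ((laplacian ^^ k) f) x"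
  using assms(3)
proof (induction k arbitrary: \<theta> f)
  case (Suc k)
  have C4: "Ck_on 4 f S"
    by (rule Ck_on_mono[OF Suc.prems]) simp
  \<comment> \<open>Peeling off the innermost Laplacian puts it next to \<open>L_op\<close>, where
    the commutation rule applies; the parameter drops by one each time.\<close>
  have "(laplacian ^^ Suc k) (L_op \<theta> f) x = (laplacian ^^ k) (laplacian (L_op \<theta> f)) x"
    by (simp only: funpow_Suc_right o_apply)
  also have "\<dots> = (laplacian ^^ k) (L_op (\<theta> - 1) (laplacian f)) x"
    by (rule laplacian_funpow_cong[OF assms(1,2)]) (rule laplacian_L_op[OF assms(1) _ C4])
  also have "\<dots> = L_op (\<theta> - 1 - real k) ((laplacian ^^ k) (laplacian f)) x"
    using Suc.prems by (intro Suc.IH Ck_on_laplacian[OF assms(1)]) (simp del: Ck_on.simps)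
  also have "\<dots> = L_op (\<theta> - real (Suc k)) ((laplacian ^^ Suc k) f) x"
    by (simp only: funpow_Suc_right o_apply) (simp add: algebra_simps)
  finally show ?case .
qed simp

text \<open>With parameter N, N commutations arrive at parameter 0, where only \<open>rho\<close>
  times the Laplacian survives. The two derivatives consumed by \<open>L_op\<close> are exactly the
  gap between 2(N+1) and 2N.\<close>

lemma polyharmonic_L_op:
  assumes "polyharmonic (Suc N) u"
  shows "polyharmonic N (L_op (real N) u)"
proof -
  have 0: "laplacian ((laplacian ^^ N) u) x = 0" if "x \<in> ball 0 1" for x
    using assms that by (simp add: polyharmonic_def del: Ck_on.simps)
  have u: "Ck_on (2 * N + 2) u (ball 0 1)"
    using assms by (simp add: polyharmonic_def del: Ck_on.simps)
  have "(laplacian ^^ N) (L_op (real N) u) x = 0" if "x \<in> ball 0 1" for x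
    using laplacian_funpow_L_op[OF open_ball that u, of "real N"] 0[OF that] by (simp add: L_op_def)
  moreover have "Ck_on (2 * N) (L_op (real N) u) (ball 0 1)"
    using u by (intro Ck_on_L_op open_ball) (simp del: Ck_on.simps)
  ultimately show ?thesis by (simp add: polyharmonic_def)
qed

section \<open>Solutions of the equation and their sums weighted by powers of
  \<open>rho\<close>\<close>

lemma L_op_zero: "L_op \<theta> (\<lambda>x. 0) x = 0"
proof -
  have "partial_deriv b (\<lambda>x. 0 :: complex) = (\<lambda>x. 0)" for b :: 'a
    by (simp add: fun_eq_iff partial_deriv_const)
  then show ?thesis by (simp add: L_op_def laplacian_def radial_deriv_def)
qed

lemma L_solution_cong:
  assumes "\<And>x. x \<in> ball 0 1 \<Longrightarrow> f x = g x"
  shows "L_solution \<theta> f \<longleftrightarrow> L_solution \<theta> g"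
proof -
  have "Ck_on 2 f (ball 0 1) \<longleftrightarrow> Ck_on 2 g (ball 0 1)"
    by (rule Ck_on_cong[OF open_ball assms])
  moreover have "L_op \<theta> f x = L_op \<theta> g x" if "x \<in> ball 0 1" for x
    by (rule L_op_cong[OF open_ball that assms])
  ultimately show ?thesis unfolding L_solution_def by simp
qed

lemma L_solutionD:
  assumes "L_solution \<theta> f"
  shows "Ck_on 2 f (ball 0 1)" "x \<in> ball 0 1 \<Longrightarrow> L_op \<theta> f x = 0"
  using assms unfolding L_solution_def by blast+

lemma L_solution_cmult:
  assumes "L_solution \<theta> f"
  shows "L_solution \<theta> (\<lambda>x. r *\<^sub>R f x)"
  unfolding L_solution_def
proof (intro conjI ballI)
  note C = L_solutionD(1)[OF assms]
  show "Ck_on 2 (\<lambda>x. r *\<^sub>R f x) (ball 0 1)"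
    by (rule Ck_on_cmult[OF open_ball C])
  show "L_op \<theta> (\<lambda>x. r *\<^sub>R f x) x = 0" if "x \<in> ball 0 1" for x
    using L_op_cmult[OF open_ball that C] L_solutionD(2)[OF assms that] by simp
qed

lemma L_solution_diff:
  assumes "L_solution \<theta> f" "L_solution \<theta> g"
  shows "L_solution \<theta> (\<lambda>x. f x - g x)"
  unfolding L_solution_def
proof (intro conjI ballI)
  note C = assms[THEN L_solutionD(1)]
  show "Ck_on 2 (\<lambda>x. f x - g x) (ball 0 1)"
    by (rule Ck_on_diff[OF open_ball C])
  show "L_op \<theta> (\<lambda>x. f x - g x) x = 0" if "x \<in> ball 0 1" for x
    using L_op_diff[OF open_ball that C] assms[THEN L_solutionD(2), OF that] by simp
qed

text \<open>With the parameter of \<open>f\<close> shifted by exactly the power of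
  \<open>rho\<close>, the operator term in \<open>L_op_rho_power_scaleR\<close> vanishes and only
  the multiple of \<open>f\<close> remains.\<close>

lemma L_op_rho_power_L_solution:
  assumes "L_solution (\<theta> - real (Suc j)) f" "x \<in> ball 0 1"
  shows "L_op \<theta> (\<lambda>x. rho x ^ Suc j *\<^sub>R f x) x = (4 * real (Suc j) * (real j - 2 * \<theta>)) *\<^sub>R (rho x ^ j *\<^sub>R f x)"
proof -
  \<comment> \<open>In the open ball |x| < 1, so the spare factor \<open>rho x\<close> can be
    cancelled.\<close>
  have "rho x \<noteq> 0"
    using assms(2) abs_square_less_1[of "norm x"] by simp
  moreover have "rho x *\<^sub>R L_op \<theta> (\<lambda>x. rho x ^ Suc j *\<^sub>R f x) x
      = rho x *\<^sub>R ((4 * real (Suc j) * (real j - 2 * \<theta>)) *\<^sub>R (rho x ^ j *\<^sub>R f x))"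
    using L_op_rho_power_scaleR[OF open_ball assms(2), of f \<theta> "Suc j"] assms
    by (simp add: L_solution_def mult.commute mult.left_commute)
  ultimately show ?thesis by (rule scaleR_left_imp_eq)
qed

text \<open>For \<theta> = m = N the hypotheses on \<open>w\<close> are those on components 1, ...,
  N at level N+1 and also those on components 0, ..., N-1 at level N, so the right-hand side is
  again a decomposition.\<close>

lemma L_op_sum_rho_power:
  assumes "\<And>j. j < m \<Longrightarrow> L_solution (\<theta> - real (Suc j)) (w j)" "x \<in> ball 0 1"
  shows "L_op \<theta> (\<lambda>x. \<Sum>j<m. rho x ^ Suc j *\<^sub>R w j x) x
    = (\<Sum>j<m. rho x ^ j *\<^sub>R ((4 * real (Suc j) * (real j - 2 * \<theta>)) *\<^sub>R w j x))"
proof -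
  have "Ck_on 2 (\<lambda>x. rho x ^ Suc j *\<^sub>R w j x) (ball 0 1)" if "j < m" for j
    using assms(1)[OF that] by (intro Ck_on_rho_power open_ball) (simp add: L_solution_def)
  then have "L_op \<theta> (\<lambda>x. \<Sum>j<m. rho x ^ Suc j *\<^sub>R w j x) x
    = (\<Sum>j<m. L_op \<theta> (\<lambda>x. rho x ^ Suc j *\<^sub>R w j x) x)"
    by (intro L_op_sum[OF open_ball assms(2)]) auto
  also have "\<dots> = (\<Sum>j<m. rho x ^ j *\<^sub>R ((4 * real (Suc j) * (real j - 2 * \<theta>)) *\<^sub>R w j x))"
  proof (rule sum.cong)
    fix j assume "j \<in> {..<m}"
    then show "L_op \<theta> (\<lambda>x. rho x ^ Suc j *\<^sub>R w j x) x
        = rho x ^ j *\<^sub>R ((4 * real (Suc j) * (real j - 2 * \<theta>)) *\<^sub>R w j x)"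
      using L_op_rho_power_L_solution[OF assms(1) assms(2), of j] by (simp only: lessThan_iff scaleR_left_commute)
  qed simp
  finally show ?thesis .
qed

subsection \<open>The decomposition\<close>

lemma polyharmonic_decomposition_exists:
  assumes "polyharmonic N u"
  shows "\<exists>w. (\<forall>j<N. L_solution (real N - real j - 1) (w j)) \<and>
    (\<forall>x\<in>ball 0 1. u x = (\<Sum>j<N. rho x ^ j *\<^sub>R w j x))"
  using assms
proof (induction N arbitrary: u)
  case 0
  \<comment> \<open>A function polyharmonic of order 0 vanishes on the ball, in agreement with the
    empty sum.\<close>
  then show ?case by (simp add: polyharmonic_def)
next
  case (Suc N)
  from Suc.IH[OF polyharmonic_L_op[OF Suc.prems]] obtain v where
    v: "\<And>j. j < N \<Longrightarrow> L_solution (real N - real j - 1) (v j)" and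
    Lu: "\<And>x. x \<in> ball 0 1 \<Longrightarrow> L_op (real N) u x = (\<Sum>j<N. rho x ^ j *\<^sub>R v j x)"
    by blast
  \<comment> \<open>The factor from \<open>L_op_sum_rho_power\<close> at \<theta> = N; it is nonzero
    since j < N forces j < 2N.\<close>
  define \<mu> where "\<mu> j = 4 * real (Suc j) * (real j - 2 * real N)" for j
  have \<mu>: "\<mu> j \<noteq> 0" if "j < N" for j
    using that by (simp add: \<mu>_def)
  \<comment> \<open>Dividing by the factor in advance makes \<open>L_op (real N)\<close> map the sum
    \<open>g\<close> onto the known decomposition of \<open>L_op (real N) u\<close>.\<close>
  define v' where "v' j = (\<lambda>x. inverse (\<mu> j) *\<^sub>R v j x)" for j
  have v': "L_solution (real N - real (Suc j)) (v' j)" if "j < N" for j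
    using L_solution_cmult[OF v[OF that]] by (simp add: v'_def algebra_simps)
  define g where "g x = (\<Sum>j<N. rho x ^ Suc j *\<^sub>R v' j x)" for x
  have Cg: "Ck_on 2 g (ball 0 1)"
    unfolding g_def[abs_def] using v'
    by (intro Ck_on_sum Ck_on_rho_power open_ball) (auto simp: L_solution_def)
  have Cu: "Ck_on 2 u (ball 0 1)"
    using Suc.prems by (auto simp: polyharmonic_def simp del: Ck_on.simps intro: Ck_on_mono)
  have Lg: "L_op (real N) g x = L_op (real N) u x" if "x \<in> ball 0 1" for x
  proof -
    have "L_op (real N) g x = (\<Sum>j<N. rho x ^ j *\<^sub>R (\<mu> j *\<^sub>R v' j x))"
      unfolding g_def[abs_def] \<mu>_def by (rule L_op_sum_rho_power[OF v' that])
    also have "\<dots> = (\<Sum>j<N. rho x ^ j *\<^sub>R v j x)"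
      by (rule sum.cong) (simp_all add: v'_def \<mu>)
    finally show ?thesis by (simp only: Lu[OF that])
  qed
  have w0: "L_solution (real N) (\<lambda>x. u x - g x)"
    unfolding L_solution_def using Ck_on_diff[OF open_ball Cu Cg] L_op_diff[OF open_ball _ Cu Cg] Lg by simp
  \<comment> \<open>Index shift: component j+1 at the new level is \<open>v' j\<close>, whose
    parameter N - (j+1) equals (N+1) - (j+1) - 1; component 0 has parameter N.\<close>
  define w where "w j = (case j of 0 \<Rightarrow> (\<lambda>x. u x - g x) | Suc i \<Rightarrow> v' i)" for j
  have "L_solution (real (Suc N) - real j - 1) (w j)" if "j < Suc N" for j
    using that w0 v' by (cases j) (simp_all add: w_def algebra_simps)
  moreover have "u x = (\<Sum>j<Suc N. rho x ^ j *\<^sub>R w j x)" for x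
    by (simp add: sum.lessThan_Suc_shift w_def g_def del: sum.lessThan_Suc power_Suc)
  ultimately show ?case by blast
qed

text \<open>By linearity uniqueness amounts to zero having only the trivial decomposition. Applying
  \<open>L_op (real N)\<close> removes \<open>w 0\<close> and leaves a vanishing sum at level N, so
  the induction hypothesis kills the higher components first, and the original relation then kills
  \<open>w 0\<close>.\<close>

lemma polyharmonic_decomposition_unique:
  assumes "\<And>j. j < N \<Longrightarrow> L_solution (real N - real j - 1) (w j)"
    and "\<And>x. x \<in> ball 0 1 \<Longrightarrow> (\<Sum>j<N. rho x ^ j *\<^sub>R w j x) = 0"
    and "j < N" "x \<in> ball 0 1"
  shows "w j x = 0"
  using assms
proof (induction N arbitrary: w j x)
  case (Suc N)
  define \<mu> where "\<mu> j = 4 * real (Suc j) * (real j - 2 * real N)" for j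
  have \<mu>: "\<mu> j \<noteq> 0" if "j < N" for j
    using that by (simp add: \<mu>_def)
  have w0: "L_solution (real N) (w 0)"
    using Suc.prems(1)[of 0] by simp
  have w: "L_solution (real N - real (Suc j)) (w (Suc j))" if "j < N" for j
    using Suc.prems(1)[of "Suc j"] that by (simp add: algebra_simps)
  define g where "g x = (\<Sum>j<N. rho x ^ Suc j *\<^sub>R w (Suc j) x)" for x
  have Cg: "Ck_on 2 g (ball 0 1)"
    unfolding g_def[abs_def] using w
    by (intro Ck_on_sum Ck_on_rho_power open_ball) (auto simp: L_solution_def)
  have sum0: "w 0 x + g x = 0" if "x \<in> ball 0 1" for x
    using Suc.prems(2)[OF that] by (simp add: sum.lessThan_Suc_shift g_def del: sum.lessThan_Suc power_Suc)
  have Lg: "(\<Sum>j<N. rho x ^ j *\<^sub>R (\<mu> j *\<^sub>R w (Suc j) x)) = 0" if x: "x \<in> ball 0 1" for x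
  proof -
    have "(\<Sum>j<N. rho x ^ j *\<^sub>R (\<mu> j *\<^sub>R w (Suc j) x)) = L_op (real N) g x"
      unfolding g_def[abs_def] \<mu>_def by (rule L_op_sum_rho_power[OF w x, symmetric])
    also have "\<dots> = L_op (real N) (\<lambda>x. w 0 x + g x) x"
      using w0 x by (simp add: L_op_add[OF open_ball x _ Cg] L_solution_def)
    also have "\<dots> = L_op (real N) (\<lambda>x. 0) x"
      by (rule L_op_cong[OF open_ball x sum0])
    finally show ?thesis by (simp add: L_op_zero)
  qed
  have sol: "L_solution (real N - real j - 1) (\<lambda>x. \<mu> j *\<^sub>R w (Suc j) x)" if "j < N" for j
    using L_solution_cmult[OF w[OF that]] by (simp add: algebra_simps)
  have zero: "w (Suc j) x = 0" if "j < N" "x \<in> ball 0 1" for j x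
    using Suc.IH[of "\<lambda>j x. \<mu> j *\<^sub>R w (Suc j) x", OF sol Lg that] \<mu>[OF that(1)] by simp
  have "w 0 x = 0"
    using sum0[OF Suc.prems(4)] zero[OF _ Suc.prems(4)] by (simp add: g_def)
  with zero[OF _ Suc.prems(4)] Suc.prems(3) show ?case
    by (cases j) auto
qed simp

text \<open>Extensional functions fix the value \<open>undefined\<close> off the ball and for
  indices at least N, so that uniqueness concerns the values in the ball alone.\<close>

theorem theorem1p3:
  fixes u :: "real ^ 'n \<Rightarrow> complex" and N :: nat
  assumes "CARD('n) \<ge> 2" and "N \<ge> 1" and "polyharmonic N u"
  shows "\<exists>!w. w \<in> {..<N} \<rightarrow>\<^sub>E (ball 0 1 \<rightarrow>\<^sub>E UNIV) \<and>
           (\<forall>j<N. L_solution (real N - real j - 1) (w j)) \<and>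
           (\<forall>x\<in>ball 0 1. u x = (\<Sum>j<N. (1 - (norm x)\<^sup>2) ^ j *\<^sub>R w j x))"
proof (rule ex_ex1I)
  from polyharmonic_decomposition_exists[OF assms(3)] obtain w where
    w: "\<And>j. j < N \<Longrightarrow> L_solution (real N - real j - 1) (w j)"
      "\<And>x. x \<in> ball 0 1 \<Longrightarrow> u x = (\<Sum>j<N. rho x ^ j *\<^sub>R w j x)"
    by blast
  \<comment> \<open>Restriction to the ball keeps the solution property, which depends only on
    values in this open set.\<close>
  have "L_solution (real N - real j - 1) (restrict (w j) (ball 0 1))" if "j < N" for j
    using w(1)[OF that] L_solution_cong[of "restrict (w j) (ball 0 1)" "w j"] by simp
  with w(2) show "\<exists>w. w \<in> {..<N} \<rightarrow>\<^sub>E (ball 0 1 \<rightarrow>\<^sub>E UNIV) \<and>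
           (\<forall>j<N. L_solution (real N - real j - 1) (w j)) \<and>
           (\<forall>x\<in>ball 0 1. u x = (\<Sum>j<N. rho x ^ j *\<^sub>R w j x))"
    by (intro exI[of _ "\<lambda>j\<in>{..<N}. restrict (w j) (ball 0 1)"]) auto
next
  fix w w'
  assume w: "w \<in> {..<N} \<rightarrow>\<^sub>E (ball 0 1 \<rightarrow>\<^sub>E UNIV) \<and>
           (\<forall>j<N. L_solution (real N - real j - 1) (w j)) \<and>
           (\<forall>x\<in>ball 0 1. u x = (\<Sum>j<N. rho x ^ j *\<^sub>R w j x))"
    and w': "w' \<in> {..<N} \<rightarrow>\<^sub>E (ball 0 1 \<rightarrow>\<^sub>E UNIV) \<and>
           (\<forall>j<N. L_solution (real N - real j - 1) (w' j)) \<and>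
           (\<forall>x\<in>ball 0 1. u x = (\<Sum>j<N. rho x ^ j *\<^sub>R w' j x))"
  have "w j x - w' j x = 0" if "j < N" "x \<in> ball 0 1" for j x
  proof (rule polyharmonic_decomposition_unique[where w = "\<lambda>j x. w j x - w' j x", OF _ _ that])
    show "L_solution (real N - real j - 1) (\<lambda>x. w j x - w' j x)" if "j < N" for j
      using w w' that by (intro L_solution_diff) auto
    show "(\<Sum>j<N. rho x ^ j *\<^sub>R (w j x - w' j x)) = 0" if "x \<in> ball 0 1" for x
      using w w' that by (simp add: scaleR_diff_right sum_subtractf del: mem_ball)
  qed
  then have eq: "w j x = w' j x" if "j < N" "x \<in> ball 0 1" for j x
    using that by simp
  show "w = w'"
  proof (rule PiE_ext[where k = "{..<N}" and s = "\<lambda>_. ball 0 1 \<rightarrow>\<^sub>E UNIV"])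
    fix j assume j: "j \<in> {..<N}"
    show "w j = w' j"
      by (rule PiE_ext[where k = "ball 0 1" and s = "\<lambda>_. UNIV"]) (use w w' j eq in auto)
  qed (use w w' in auto)
qed

end
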